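(* Let $\mathbb F$ be a field, let $d\geq 1$ be an integer, and consider the vector space $V=\mathbb F^{d+1}$. Assume that $n=d+1$ is prime and that ${\rm Char}(\mathbb F)=n$. Pick $\gamma\in\mathbb F$ that is not among $0,1,2,\ldots,d$. Define a matrix $A\in{\rm Mat}_{d+1}(\mathbb F)$ as follows: $A_{i,i}=i+\gamma$ for $0\le i\le d$; $A_{0,d}=-\gamma$; $A_{i,i-1}=-i-\gamma$ for $1\le i\le d$; all other entries of $A$ are zero. Define a diagonal matrix $A^*\in{\rm Mat}_{d+1}(\mathbb F)$ with $A^*_{i,i}=i$ for $0\le i\le d$. Then the pair $A,A^*$ acts on $V$ as a circular bidiagonal pair. Moreover $$A^n=A,\qquad (A^* )^n=A^*,\qquad AA^*-A^*A+A-A^*=\gamma I.$$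
   Context: $\mathbb F^{d+1}$ consists of column vectors, on which ${\rm Mat}_{d+1}(\mathbb F)$ acts by left multiplication; rows, columns and coordinates are indexed by $0,1,\ldots,d$. $I$ is the identity matrix. (Here $A^*$ is just a name for a second matrix.) For $d\ge 1$, a matrix in ${\rm Mat}_{d+1}(\mathbb F)$ is circular bidiagonal whenever (i) each nonzero entry is on the diagonal, or the subdiagonal (entries $(i,i-1)$, $1\le i\le d$), or in the top-right corner (entry $(0,d)$); (ii) each subdiagonal entry is nonzero and the top-right corner entry is nonzero. A circular bidiagonal pair on a $(d+1)$-dimensional vector space $V$ over $\mathbb F$ is an ordered pair of $\mathbb F$-linear maps $A:V\to V$, $A^*:V\to V$ such that (i) there exists a basis for $V$ with respect to which the matrix representing $A$ is circular bidiagonal and the matrix representing $A^*$ is diagonal; (ii) there exists a basis for $V$ with respect to which the matrix representing $A^*$ is circular bidiagonal and the matrix representing $A$ is diagonal. Here a matrix $X$ represents $A$ with respect to a basis $\{v_i\}_{i=0}^d$ whenever $Av_j=\sum_i X_{i,j}v_i$ for all $j$. *)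

theory Defs
  imports "Jordan_Normal_Form.VS_Connect"
begin

text \<open>Rows, columns and coordinates are indexed by \<open>0, \<dots>, d\<close>, matching the zero-based
  indexing of \<open>'a mat\<close> and \<open>'a vec\<close>. The field is the carrier of the type \<open>'a\<close>, seen as a ring
  record through \<open>class_ring\<close>.\<close>

definition circular_bidiagonal :: "nat \<Rightarrow> 'a :: field mat \<Rightarrow> bool" where
  "circular_bidiagonal d X \<longleftrightarrow>
     1 \<le> d \<and> X \<in> carrier_mat (d + 1) (d + 1) \<and>
     (\<forall>i\<le>d. \<forall>j\<le>d. X $$ (i, j) \<noteq> 0 \<longrightarrow> i = j \<or> i = j + 1 \<or> (i = 0 \<and> j = d)) \<and>
     (\<forall>i. 1 \<le> i \<and> i \<le> d \<longrightarrow> X $$ (i, i - 1) \<noteq> 0) \<and>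
     X $$ (0, d) \<noteq> 0"

text \<open>The library's \<open>basis\<close> is a predicate on sets; an ordered basis \<open>v 0, \<dots>, v d\<close> is an
  injective enumeration of such a set. Values of \<open>v\<close> beyond \<open>d\<close> are irrelevant.\<close>

definition ordered_basis ::
  "nat \<Rightarrow> ('a :: field, 'v, 'm) module_scheme \<Rightarrow> (nat \<Rightarrow> 'v) \<Rightarrow> bool" where
  "ordered_basis d V v \<longleftrightarrow> inj_on v {0..d} \<and> vectorspace.basis class_ring V (v ` {0..d})"

definition represents ::
  "nat \<Rightarrow> ('a :: field, 'v, 'm) module_scheme \<Rightarrow> (nat \<Rightarrow> 'v) \<Rightarrow> 'a mat \<Rightarrow> ('v \<Rightarrow> 'v) \<Rightarrow> bool" where
  "represents d V v X T \<longleftrightarrow>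
     X \<in> carrier_mat (d + 1) (d + 1) \<and>
     (\<forall>j\<le>d. T (v j) = (\<Oplus>\<^bsub>V\<^esub>i\<in>{0..d}. X $$ (i, j) \<odot>\<^bsub>V\<^esub> v i))"

definition circular_bidiagonal_pair ::
  "nat \<Rightarrow> ('a :: field, 'v, 'm) module_scheme \<Rightarrow> ('v \<Rightarrow> 'v) \<Rightarrow> ('v \<Rightarrow> 'v) \<Rightarrow> bool" where
  "circular_bidiagonal_pair d V A Astar \<longleftrightarrow>
     vectorspace class_ring V \<and>
     vectorspace.fin_dim class_ring V \<and> vectorspace.dim class_ring V = d + 1 \<and>
     linear_map class_ring V V A \<and> linear_map class_ring V V Astar \<and>
     (\<exists>v X Y. ordered_basis d V v \<and> represents d V v X A \<and> represents d V v Y Astar \<and>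
        circular_bidiagonal d X \<and> diagonal_mat Y) \<and>
     (\<exists>v X Y. ordered_basis d V v \<and> represents d V v X A \<and> represents d V v Y Astar \<and>
        diagonal_mat X \<and> circular_bidiagonal d Y)"

end

theory Submission
  imports Defs "HOL-Number_Theory.Cong"
begin

text \<open>
  Write \<open>P\<close> for the matrix whose column \<open>k\<close> lists the falling factorials
  \<open>(\<gamma> + i) (\<gamma> + i - 1) \<dots> (\<gamma> + i - k + 1)\<close>, \<open>0 \<le> i \<le> d\<close>. Since \<open>d + 1 = 0\<close> in the field, the
  index \<open>i\<close> may be read modulo \<open>d + 1\<close>, and column \<open>k\<close> is an eigenvector of \<open>A\<close> for the
  eigenvalue \<open>k\<close>. Its entries do not vanish at \<open>i = 0\<close>, so \<open>P\<close> is invertible, and \<open>A\<close>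
  inherits \<open>A ^ n = A\<close> from Fermat's little theorem for its eigenvalues. Multiplication by
  \<open>i = (k - \<gamma>) + (\<gamma> + i - k)\<close> carries column \<open>k\<close> to \<open>k - \<gamma>\<close> times itself plus column \<open>k + 1\<close>,
  and column \<open>d + 1\<close> would be constant, i.e. a nonzero multiple of column \<open>0\<close>. Hence \<open>A\<^sup>*\<close> is
  circular bidiagonal in the basis of columns of \<open>P\<close>, while the standard basis serves for the
  other half of the definition.
\<close>

text \<open>Fermat's little theorem, by induction: in prime characteristic p the power map is
  additive, so \<open>(1 + k) ^ p = 1 + k ^ p\<close>.\<close>

lemma of_nat_power_CHAR:
  assumes "prime CHAR('a :: comm_semiring_1)"
  shows "(of_nat k :: 'a) ^ CHAR('a) = of_nat k"
proof (induction k)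
  case 0
  then show ?case using prime_gt_0_nat[OF assms] by (simp add: power_0_left)
next
  case (Suc k)
  then show ?case using freshmans_dream[OF assms refl, of 1 "of_nat k"] by simp
qed

section \<open>Linear maps and ordered bases given by matrices\<close>

lemma linear_map_mult_mat_vec:
  fixes B :: "'a :: field mat"
  assumes B: "B \<in> carrier_mat n n"
  shows "linear_map class_ring (module_vec TYPE('a) n) (module_vec TYPE('a) n) (\<lambda>v. B *\<^sub>v v)"
proof -
  interpret vec_space "TYPE('a)" n .
  show ?thesis
    unfolding linear_map_def mod_hom_def mod_hom_axioms_def LinearCombinations.module_hom_def
    using B vec_vs vec_module
    by (auto simp: module_vec_simps class_ring_simps mult_add_distrib_mat_vec mult_mat_vec)
qed

lemma ordered_basis_cols:
  fixes P :: "'a :: field mat"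
  assumes P: "P \<in> carrier_mat (d + 1) (d + 1)" and det: "det P \<noteq> 0"
  shows "ordered_basis d (module_vec TYPE('a) (d + 1)) (col P)"
proof -
  interpret vec_space "TYPE('a)" "d + 1" .
  have inj: "inj_on (col P) {0..d}"
  proof (rule inj_onI, rule ccontr)
    fix i j assume "i \<in> {0..d}" "j \<in> {0..d}" "col P i = col P j" "i \<noteq> j"
    then show False using det_identical_columns[OF P, of i j] det by auto
  qed
  have cols: "col P ` {0..d} = set (cols P)"
    using P unfolding cols_def by (simp add: atLeastLessThanSuc_atLeastAtMost del: upt_Suc)
  have "basis (set (cols P))"
  proof (rule dim_li_is_basis)
    show "set (cols P) \<subseteq> carrier_vec (d + 1)" using P cols_dim[of P] by auto
    show "lin_indpt (set (cols P))" using lin_dep_cols_imp_det_0[OF P] det by auto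
    show "dim \<le> card (set (cols P))"
      using card_image[OF inj] unfolding cols dim_is_n by simp
  qed (rule fin_dim finite_set)+
  then show ?thesis using inj unfolding ordered_basis_def cols by simp
qed

text \<open>The equation \<open>B * P = P * X\<close> is read column by column: column
  \<open>j\<close> of \<open>P * X\<close> combines the columns of \<open>P\<close> with the entries
  of column \<open>j\<close> of \<open>X\<close> as coefficients. Both halves of the pair condition
  thus become matrix identities.\<close>

lemma represents_cols:
  fixes B P X :: "'a :: field mat"
  assumes P: "P \<in> carrier_mat (d + 1) (d + 1)" and B: "B \<in> carrier_mat (d + 1) (d + 1)"
    and X: "X \<in> carrier_mat (d + 1) (d + 1)" and eq: "B * P = P * X"
  shows "represents d (module_vec TYPE('a) (d + 1)) (col P) X (\<lambda>v. B *\<^sub>v v)"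
proof -
  interpret vec_space "TYPE('a)" "d + 1" .
  have "B *\<^sub>v col P j = finsum V (\<lambda>i. X $$ (i, j) \<cdot>\<^sub>v col P i) {0..d}" if j: "j \<le> d" for j
  proof (rule eq_vecI)
    have closed: "(\<lambda>i. X $$ (i, j) \<cdot>\<^sub>v col P i) \<in> {0..d} \<rightarrow> carrier_vec (d + 1)"
      using carrier_matD[OF P] by (auto intro!: carrier_vecI)
    then have dim: "dim_vec (finsum V (\<lambda>i. X $$ (i, j) \<cdot>\<^sub>v col P i) {0..d}) = d + 1"
      by (intro finsum_dim) auto
    then show "dim_vec (B *\<^sub>v col P j) = dim_vec (finsum V (\<lambda>i. X $$ (i, j) \<cdot>\<^sub>v col P i) {0..d})"
      using B by simp
    fix r assume "r < dim_vec (finsum V (\<lambda>i. X $$ (i, j) \<cdot>\<^sub>v col P i) {0..d})"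
    then have r: "r < d + 1" using dim by simp
    have "(B *\<^sub>v col P j) $ r = (B * P) $$ (r, j)"
      using B P r j by simp
    also have "\<dots> = (\<Sum>i = 0..d. X $$ (i, j) * P $$ (r, i))"
      unfolding eq using X P r j
      by (auto simp: scalar_prod_def atLeastLessThanSuc_atLeastAtMost mult.commute intro!: sum.cong)
    also have "\<dots> = (\<Sum>i = 0..d. (X $$ (i, j) \<cdot>\<^sub>v col P i) $ r)"
      using P r by (intro sum.cong) auto
    also have "\<dots> = finsum V (\<lambda>i. X $$ (i, j) \<cdot>\<^sub>v col P i) {0..d} $ r"
      using index_finsum_vec[OF _ r closed] unfolding finsum_vec by (simp del: Suc_eq_plus1 add_Suc_right)
    finally show "(B *\<^sub>v col P j) $ r = finsum V (\<lambda>i. X $$ (i, j) \<cdot>\<^sub>v col P i) {0..d} $ r" .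
  qed
  then show ?thesis using X unfolding represents_def by (simp add: module_vec_simps)
qed

section \<open>Independence of eigenvectors for distinct eigenvalues\<close>

lemma eigenvectors_sum_eq_0_imp:
  fixes f c :: "nat \<Rightarrow> 'a :: field" and v :: "nat \<Rightarrow> 'a vec"
  assumes B: "B \<in> carrier_mat n n"
    and v: "\<And>k. k \<in> S \<Longrightarrow> v k \<in> carrier_vec n"
    and eigen: "\<And>k. k \<in> S \<Longrightarrow> B *\<^sub>v v k = f k \<cdot>\<^sub>v v k"
    and nz: "\<And>k. k \<in> S \<Longrightarrow> v k \<noteq> 0\<^sub>v n"
    and "finite S" and "inj_on f S"
    and "\<And>i. i < n \<Longrightarrow> (\<Sum>k\<in>S. c k * v k $ i) = 0"
    and "k \<in> S"
  shows "c k = 0"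
  using assms(5,6,7,8) v eigen nz
proof (induction S arbitrary: c k rule: finite_induct)
  case empty
  then show ?case by simp
next
  case (insert s S)
  have entry: "f k * v k $ i = (\<Sum>j = 0..<n. B $$ (i, j) * v k $ j)"
    if "k \<in> insert s S" "i < n" for k i
  proof -
    have "(B *\<^sub>v v k) $ i = (f k \<cdot>\<^sub>v v k) $ i" using insert.prems(5) that by simp
    then show ?thesis
      using B insert.prems(4)[OF that(1)] that(2) by (auto simp: scalar_prod_def)
  qed
  \<comment> \<open>This is \<open>B\<close> applied to the given linear relation, in
    coordinates.\<close>
  have zero: "(\<Sum>k\<in>insert s S. c k * (f k * v k $ i)) = 0" if i: "i < n" for i
  proof -
    have "(\<Sum>k\<in>insert s S. c k * (f k * v k $ i))
        = (\<Sum>k\<in>insert s S. \<Sum>j = 0..<n. B $$ (i, j) * (c k * v k $ j))"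
      using entry i by (intro sum.cong) (auto simp: sum_distrib_left mult_ac)
    also have "\<dots> = (\<Sum>j = 0..<n. B $$ (i, j) * (\<Sum>k\<in>insert s S. c k * v k $ j))"
      by (subst sum.swap) (simp add: sum_distrib_left)
    also have "\<dots> = 0" using insert.prems(2) by (intro sum.neutral) auto
    finally show ?thesis .
  qed
  \<comment> \<open>Applying \<open>B\<close> minus \<open>f s\<close> to the relation removes the
    vector \<open>v s\<close> and multiplies each other coefficient by \<open>f k - f s\<close>, a
    nonzero factor by injectivity of \<open>f\<close>.\<close>
  have S0: "c k * (f k - f s) = 0" if "k \<in> S" for k
  proof (rule insert.IH[where c = "\<lambda>k. c k * (f k - f s)"])
    fix i assume i: "i < n"
    have "(\<Sum>k\<in>S. c k * (f k - f s) * v k $ i)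
        = (\<Sum>k\<in>insert s S. c k * (f k * v k $ i)) - f s * (\<Sum>k\<in>insert s S. c k * v k $ i)"
      using insert.hyps by (simp add: sum_distrib_left algebra_simps flip: sum_subtractf)
    then show "(\<Sum>k\<in>S. c k * (f k - f s) * v k $ i) = 0"
      using zero[OF i] insert.prems(2)[OF i] by simp
  qed (use that insert.prems in auto)
  have cS: "c k = 0" if "k \<in> S" for k
    using S0[OF that] insert.prems(1) insert.hyps(2) that by (auto simp: inj_on_def)
  have "c s * v s $ i = 0" if "i < n" for i
    using insert.prems(2)[OF that] insert.hyps cS by simp
  moreover obtain i where "i < n" "v s $ i \<noteq> 0"
  proof -
    have "v s \<in> carrier_vec n" "v s \<noteq> 0\<^sub>v n" using insert.prems by auto
    then show ?thesis using that by (metis carrier_vecD eq_vecI index_zero_vec)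
  qed
  ultimately have "c s = 0" by auto
  then show ?case using cS insert.prems(3) by auto
qed

text \<open>A nonzero kernel vector of \<open>P\<close> would be a nontrivial linear relation among
  its columns, which are eigenvectors of \<open>B\<close> for distinct eigenvalues.\<close>

lemma det_eigenvector_matrix_nonzero:
  fixes B P :: "'a :: field mat"
  assumes B: "B \<in> carrier_mat n n" and P: "P \<in> carrier_mat n n"
    and eq: "B * P = P * mat_diag n f"
    and inj: "inj_on f {0..<n}" and nz: "\<And>k. k < n \<Longrightarrow> col P k \<noteq> 0\<^sub>v n"
  shows "det P \<noteq> 0"
proof
  assume "det P = 0"
  then obtain w where w: "w \<in> carrier_vec n" "w \<noteq> 0\<^sub>v n" "P *\<^sub>v w = 0\<^sub>v n"
    using det_0_iff_vec_prod_zero_field[OF P] by auto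
  have eigen: "B *\<^sub>v col P k = f k \<cdot>\<^sub>v col P k" if k: "k < n" for k
  proof -
    have "B *\<^sub>v col P k = col (B * P) k" using col_mult2[OF B P k] by simp
    also have "\<dots> = f k \<cdot>\<^sub>v col P k"
      unfolding eq mat_diag_mult_right[OF P] using P k by (intro eq_vecI) auto
    finally show ?thesis .
  qed
  have "(\<Sum>k = 0..<n. w $ k * col P k $ i) = 0" if i: "i < n" for i
  proof -
    have "(P *\<^sub>v w) $ i = 0" using w(3) i by simp
    then show ?thesis
      using P w(1) i by (simp add: scalar_prod_def mult.commute)
  qed
  then have "w $ k = 0" if "k < n" for k
    using eigenvectors_sum_eq_0_imp[OF B, of "{0..<n}" "col P" f "\<lambda>k. w $ k" k]
      P eigen inj nz that by auto
  then show False using w(1,2) by (metis carrier_vecD eq_vecI index_zero_vec)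
qed

section \<open>Transfer of matrix powers along an intertwining matrix\<close>

lemma pow_mat_intertwine:
  assumes "B \<in> carrier_mat n n" "P \<in> carrier_mat n n" "D \<in> carrier_mat n n"
    and "B * P = P * (D :: 'a :: semiring_1 mat)"
  shows "B ^\<^sub>m k * P = P * D ^\<^sub>m k"
proof (induction k)
  case 0
  then show ?case using assms by simp
next
  case (Suc k)
  have "B ^\<^sub>m Suc k * P = B ^\<^sub>m k * (P * D)"
    using assms by (simp add: assoc_mult_mat[of _ n n _ n _ n])
  also have "\<dots> = P * D ^\<^sub>m Suc k"
    using assms Suc by (simp flip: assoc_mult_mat[of _ n n _ n _ n])
  finally show ?case .
qed

lemma mat_diag_pow: "mat_diag n f ^\<^sub>m k = mat_diag n (\<lambda>i. f i ^ k :: 'a :: semiring_1)"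
proof (induction k)
  case 0
  then show ?case by (simp add: mat_diag_def one_mat_def)
next
  case (Suc k)
  then show ?case by (simp add: power_commutes)
qed

lemma mult_mat_right_cancel:
  fixes B C P :: "'a :: field mat"
  assumes B: "B \<in> carrier_mat n n" and C: "C \<in> carrier_mat n n"
    and P: "P \<in> carrier_mat n n" and det: "det P \<noteq> 0" and eq: "B * P = C * P"
  shows "B = C"
proof -
  obtain Q where Q: "Q \<in> carrier_mat n n" "P * Q = 1\<^sub>m n"
    using det_non_zero_imp_unit[OF P det, of "()"] unfolding Units_def ring_mat_def by auto
  have "B = B * P * Q" using B P Q by (simp add: assoc_mult_mat[of _ n n _ n _ n])
  also have "\<dots> = C" unfolding eq using C P Q by (simp add: assoc_mult_mat[of _ n n _ n _ n])
  finally show ?thesis .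
qed

section \<open>Falling factorials\<close>

definition falling_mat :: "nat \<Rightarrow> 'a :: field \<Rightarrow> 'a mat" where
  "falling_mat d \<gamma> = mat (d + 1) (d + 1) (\<lambda>(i, k). \<Prod>m<k. \<gamma> + of_nat i - of_nat m)"

lemma falling_mat_carrier [simp]: "falling_mat d \<gamma> \<in> carrier_mat (d + 1) (d + 1)"
  unfolding falling_mat_def by (rule mat_carrier)

text \<open>Both sides are x(x - 1)...(x - k), with the first or the last factor split off.\<close>

lemma falling_shift:
  fixes x :: "'a :: comm_ring_1"
  shows "x * (\<Prod>m<k. x - 1 - of_nat m) = (\<Prod>m<k. x - of_nat m) * (x - of_nat k)"
proof (induction k)
  case (Suc k)
  have "x * (\<Prod>m<Suc k. x - 1 - of_nat m) = x * (\<Prod>m<k. x - 1 - of_nat m) * (x - 1 - of_nat k)"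
    by (simp add: mult.assoc)
  then show ?case unfolding Suc.IH by (simp add: diff_diff_eq)
qed simp

text \<open>Lowering the argument y by 1 trades the factor y for y - (d + 1), which is y again
  because d + 1 = 0 in the field.\<close>

lemma falling_periodic:
  fixes x :: "'a :: field"
  assumes "of_nat (d + 1) = (0 :: 'a)"
  shows "(\<Prod>m<d + 1. x + of_nat i - of_nat m) = (\<Prod>m<d + 1. x - of_nat m)"
proof (induction i)
  case (Suc i)
  let ?y = "x + of_nat (Suc i)"
  have "?y - 1 - of_nat d = ?y" using assms by (simp add: algebra_simps)
  then have "(\<Prod>m<d + 1. ?y - 1 - of_nat m) = ?y * (\<Prod>m<d. ?y - 1 - of_nat m)"
    by (simp add: mult.commute)
  also have "\<dots> = (\<Prod>m<d + 1. ?y - of_nat m)"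
    unfolding falling_shift by simp
  finally have "(\<Prod>m<d + 1. ?y - of_nat m) = (\<Prod>m<d + 1. ?y - 1 - of_nat m)" ..
  moreover have "?y - 1 = x + of_nat i" by simp
  ultimately show ?case using Suc.IH by (simp only:)
qed simp

section \<open>The pair and its matrix identities\<close>

theorem lemma2p10:
  fixes d n :: nat and \<gamma> :: "'a :: field" and A Astar :: "'a mat"
  assumes "d \<ge> 1" and "n = d + 1" and "prime n" and "CHAR('a) = n"
    and "\<gamma> \<notin> of_nat ` {0..d}"
    and "A = mat (d + 1) (d + 1) (\<lambda>(i, j).
           if i = j then of_nat i + \<gamma>
           else if i = 0 \<and> j = d then - \<gamma>
           else if 1 \<le> i \<and> j = i - 1 then - of_nat i - \<gamma>
           else 0)"
    and "Astar = mat (d + 1) (d + 1) (\<lambda>(i, j). if i = j then of_nat i else 0)"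
  shows "circular_bidiagonal_pair d (module_vec TYPE('a) (d + 1))
           (\<lambda>v. A *\<^sub>v v) (\<lambda>v. Astar *\<^sub>v v)
       \<and> A ^\<^sub>m n = A \<and> Astar ^\<^sub>m n = Astar
       \<and> A * Astar - Astar * A + A - Astar = \<gamma> \<cdot>\<^sub>m 1\<^sub>m (d + 1)"
proof -
  \<comment> \<open>\<open>D\<close> has two roles: it equals \<open>Astar\<close>, and it is the
    diagonal matrix of eigenvalues of \<open>A\<close>.\<close>
  define D :: "'a mat" where "D = mat_diag (d + 1) of_nat"
  define P where "P = falling_mat d \<gamma>"
  \<comment> \<open>The constant value that a column \<open>d + 1\<close> of falling factorials
    would have; it becomes the corner entry of \<open>Y\<close>, the matrix of \<open>Astar\<close>
    in the basis of columns of \<open>P\<close>.\<close>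
  define c where "c = (\<Prod>m<d + 1. \<gamma> - of_nat m)"
  define Y :: "'a mat" where "Y = mat (d + 1) (d + 1) (\<lambda>(i, k).
    if i = k then of_nat k - \<gamma> else if i = 0 \<and> k = d then c else if i = k + 1 then 1 else 0)"
  have A: "A \<in> carrier_mat (d + 1) (d + 1)" and P: "P \<in> carrier_mat (d + 1) (d + 1)"
    and D: "D \<in> carrier_mat (d + 1) (d + 1)" and Y: "Y \<in> carrier_mat (d + 1) (d + 1)"
    unfolding assms(6) P_def D_def Y_def by (rule mat_carrier falling_mat_carrier mat_diag_dim)+
  have Astar: "Astar = D"
    unfolding assms(7) D_def mat_diag_def by (intro eq_matI) auto
  have char: "of_nat (d + 1) = (0 :: 'a)"
    using assms(2,4) by (metis of_nat_CHAR)
  then have d_eq: "of_nat d = (-1 :: 'a)"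
    by (simp add: eq_neg_iff_add_eq_0 add.commute)
  have inj: "inj_on (of_nat :: nat \<Rightarrow> 'a) {0..<d + 1}"
    using assms(2,4) by (auto simp: inj_on_def of_nat_eq_iff_cong_CHAR cong_def)
  have \<gamma>_ne: "\<gamma> \<noteq> of_nat m" if "m \<le> d" for m
    using assms(5) that by auto

  \<comment> \<open>The cyclic predecessor. As d = -1 in the field, it acts as subtraction of 1 even
    at \<open>i = 0\<close>, so the corner of \<open>A\<close> follows the same rule as the
    subdiagonal.\<close>
  define pre where "pre i = (if i = 0 then d else i - 1)" for i :: nat
  have pre: "(of_nat (pre i) :: 'a) = of_nat i - 1" "pre i < d + 1" if "i < d + 1" for i
    using that d_eq by (auto simp: pre_def of_nat_diff)
  have AP: "A * P = P * D"
  proof (rule eq_matI)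
    fix i k assume "i < dim_row (P * D)" "k < dim_col (P * D)"
    then have i: "i < d + 1" and k: "k < d + 1" using P D by auto
    have entry: "A $$ (i, j) = (if j = i then of_nat i + \<gamma> else 0)
        - (if j = pre i then of_nat i + \<gamma> else 0)" if "j < d + 1" for j
      using assms(1,6) i that by (auto simp: pre_def)
    have "(A * P) $$ (i, k) = (\<Sum>j = 0..<d + 1. A $$ (i, j) * P $$ (j, k))"
      using A P i k by (simp add: scalar_prod_def)
    also have "\<dots> = (\<Sum>j = 0..<d + 1. (if j = i then (of_nat i + \<gamma>) * P $$ (j, k) else 0)
        - (if j = pre i then (of_nat i + \<gamma>) * P $$ (j, k) else 0))"
      by (intro sum.cong refl) (subst entry, auto simp: algebra_simps)
    also have "\<dots> = (of_nat i + \<gamma>) * P $$ (i, k) - (of_nat i + \<gamma>) * P $$ (pre i, k)"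
      using i pre(2)[OF i] by (simp add: sum_subtractf)
    \<comment> \<open>This is \<open>falling_shift\<close> at x = \<gamma> + i. Subtracting it from
      x \<open>P $$ (i, k)\<close> leaves the factor x - (x - k) = k, the eigenvalue.\<close>
    also have "(of_nat i + \<gamma>) * P $$ (pre i, k) = P $$ (i, k) * (\<gamma> + of_nat i - of_nat k)"
    proof -
      have "P $$ (pre i, k) = (\<Prod>m<k. \<gamma> + of_nat i - 1 - of_nat m)"
        using k pre[OF i] by (simp add: P_def falling_mat_def add_diff_eq)
      then show ?thesis
        using falling_shift[of "\<gamma> + of_nat i" k] i k
        by (simp add: P_def falling_mat_def add.commute)
    qed
    also have "(of_nat i + \<gamma>) * P $$ (i, k) - P $$ (i, k) * (\<gamma> + of_nat i - of_nat k)
        = (P * D) $$ (i, k)"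
      unfolding D_def mat_diag_mult_right[OF P] using i k by (simp add: algebra_simps)
    finally show "(A * P) $$ (i, k) = (P * D) $$ (i, k)" .
  qed (use A P D in auto)

  have "col P k \<noteq> 0\<^sub>v (d + 1)" if k: "k < d + 1" for k
  proof
    assume "col P k = 0\<^sub>v (d + 1)"
    then have "col P k $ 0 = 0" by simp
    then show False using k \<gamma>_ne by (simp add: P_def falling_mat_def)
  qed
  then have det: "det P \<noteq> 0"
    using det_eigenvector_matrix_nonzero[OF A P AP[unfolded D_def] inj] by simp

  have DP: "D * P = P * Y"
  proof (rule eq_matI)
    fix i k assume "i < dim_row (P * Y)" "k < dim_col (P * Y)"
    then have i: "i < d + 1" and k: "k < d + 1" using P Y by auto
    \<comment> \<open>Cyclic successor of the column index, with the coefficient picked up: wrapping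
      from column \<open>d\<close> to column \<open>0\<close> costs the factor
      \<open>c\<close>.\<close>
    define s where "s = (if k = d then 0 else k + 1)"
    define e where "e = (if k = d then c else 1)"
    have s: "s < d + 1" using k by (simp add: s_def)
    have entry: "Y $$ (j, k) = (if j = k then of_nat k - \<gamma> else 0) + (if j = s then e else 0)"
      if "j < d + 1" for j
      using assms(1) k that by (auto simp: Y_def s_def e_def)
    \<comment> \<open>For \<open>k = d\<close> the entry in column \<open>0\<close> is the empty
      product 1, and the right side is the full product of d + 1 factors, equal to \<open>c\<close>
      by periodicity.\<close>
    have step: "P $$ (i, s) * e = P $$ (i, k) * (\<gamma> + of_nat i - of_nat k)"
    proof (cases "k = d")
      case True
      then show ?thesis using i falling_periodic[OF char, of \<gamma> i]
        by (simp add: P_def falling_mat_def s_def e_def c_def)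
    next
      case False
      then show ?thesis using i k
        by (simp add: P_def falling_mat_def s_def e_def)
    qed
    have "(P * Y) $$ (i, k) = (\<Sum>j = 0..<d + 1. P $$ (i, j) * Y $$ (j, k))"
      using P Y i k by (simp add: scalar_prod_def)
    also have "\<dots> = (\<Sum>j = 0..<d + 1. (if j = k then P $$ (i, j) * (of_nat k - \<gamma>) else 0)
        + (if j = s then P $$ (i, j) * e else 0))"
      by (intro sum.cong refl) (subst entry, auto simp: algebra_simps)
    also have "\<dots> = P $$ (i, k) * (of_nat k - \<gamma>) + P $$ (i, s) * e"
      using k s by (simp add: sum.distrib)
    also have "\<dots> = (D * P) $$ (i, k)"
      unfolding step D_def mat_diag_mult_left[OF P] using i k by (simp add: algebra_simps)
    finally show "(D * P) $$ (i, k) = (P * Y) $$ (i, k)" by simp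
  qed (use P D Y in auto)

  have fermat: "(of_nat k :: 'a) ^ n = of_nat k" for k
    using of_nat_power_CHAR[where ?'a = 'a] assms(3,4) by simp
  have D_pow: "D ^\<^sub>m n = D"
    unfolding D_def mat_diag_pow fermat ..
  \<comment> \<open>\<open>A ^\<^sub>m n * P = P * D ^\<^sub>m n = P * D = A * P\<close>, and then
    the invertible \<open>P\<close> is cancelled.\<close>
  have "A ^\<^sub>m n * P = A * P"
    using pow_mat_intertwine[OF A P D AP, of n] D_pow AP by simp
  then have A_pow: "A ^\<^sub>m n = A"
    using mult_mat_right_cancel[OF _ A P det] A by simp

  \<comment> \<open>Off the diagonal the entry (i, j) of the left side is (j - i + 1) times that of
    \<open>A\<close>. The factor vanishes on the subdiagonal, and at the corner it is d + 1 = 0. On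
    the diagonal the commutator is zero and (i + \<gamma>) - i = \<gamma> remains.\<close>
  have comm: "A * D - D * A + A - D = \<gamma> \<cdot>\<^sub>m 1\<^sub>m (d + 1)"
    unfolding D_def mat_diag_mult_left[OF A] mat_diag_mult_right[OF A]
    by (intro eq_matI)
      (use assms(1) d_eq in \<open>auto simp: assms(6) mat_diag_def algebra_simps of_nat_diff\<close>)

  have "c \<noteq> 0" using \<gamma>_ne by (auto simp: c_def)
  then have cbY: "circular_bidiagonal d Y"
    using assms(1) by (auto simp: circular_bidiagonal_def Y_def split: if_splits)
  \<comment> \<open>In the field -i equals d + 1 - i, which is among the values 1, ..., d excluded
    for \<gamma>.\<close>
  have "- of_nat i - \<gamma> \<noteq> 0" if "1 \<le> i" "i \<le> d" for i
  proof -
    have "\<gamma> \<noteq> of_nat (d + 1 - i)" by (rule \<gamma>_ne) (use that in simp)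
    moreover have "of_nat (d + 1 - i) = (- of_nat i :: 'a)"
      using that char by (subst of_nat_diff) auto
    ultimately show ?thesis by (metis eq_iff_diff_eq_0)
  qed
  then have cbA: "circular_bidiagonal d A"
    using assms(1) \<gamma>_ne[of 0] by (auto simp: circular_bidiagonal_def assms(6) split: if_splits)
  have diag: "diagonal_mat D"
    by (auto simp: diagonal_mat_def D_def mat_diag_def)

  interpret vec_space "TYPE('a)" "d + 1" .
  \<comment> \<open>The standard basis is taken as the columns of the identity, so that
    \<open>ordered_basis_cols\<close> and \<open>represents_cols\<close> serve both halves.\<close>
  let ?I = "1\<^sub>m (d + 1) :: 'a mat"
  have "circular_bidiagonal_pair d (module_vec TYPE('a) (d + 1)) (\<lambda>v. A *\<^sub>v v) (\<lambda>v. D *\<^sub>v v)"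
    unfolding circular_bidiagonal_pair_def
  proof (intro conjI exI)
    show "ordered_basis d V (col ?I)" by (rule ordered_basis_cols) auto
    show "represents d V (col ?I) A ((*\<^sub>v) A)" "represents d V (col ?I) D ((*\<^sub>v) D)"
      by (rule represents_cols; use A D in simp)+
    show "ordered_basis d V (col P)" by (rule ordered_basis_cols[OF P det])
    show "represents d V (col P) D ((*\<^sub>v) A)" by (rule represents_cols[OF P A D AP])
    show "represents d V (col P) Y ((*\<^sub>v) D)" by (rule represents_cols[OF P D Y DP])
  qed (use cbA cbY diag vec_vs fin_dim dim_is_n linear_map_mult_mat_vec A D in auto)
  then show ?thesis using A_pow D_pow comm unfolding Astar by simp
qed

end
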